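(* Let $\delta>0$ be any real number, let $P_\delta:=[0,2\pi)\times[-\delta,\delta]$, and let $$\mathbf{w}(t,r):=\big(\cos t+r\cos\tfrac t2,\ \sin t+r\sin\tfrac t2,\ r\sin\tfrac t2\big)\in\mathbb{R}^3\quad\text{for }(t,r)\in P_\delta.$$ Let $$S_\delta:=\big\{(x,y)\in\mathbb{R}^2\setminus\{(-1,0)\}\colon g(x,y)\le\delta^2\big\},\qquad g(x,y):=\frac{(x^2+y^2-1)^2}{(x+1)^2+y^2},$$ and let $f\colon S_\delta\to\mathbb{R}$ be the rational function $$f(x,y):=y-\frac{2(x+1)y}{(x+1)^2+y^2}=y\,\frac{x^2+y^2-1}{(x+1)^2+y^2}.$$ Then the image $\mathbf{w}(P_\delta)$ coincides with the topological closure in $\mathbb{R}^3$ of the graph $\{(x,y,f(x,y))\colon(x,y)\in S_\delta\}$ of $f$.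
   Context: The closure is taken with respect to the standard topology of $\mathbb{R}^3$. *)

theory Defs
  imports "HOL-Analysis.Analysis"
begin

text \<open>
  Euclidean 3-space is rendered as \<^typ>\<open>real \<times> real \<times> real\<close>, whose topology (the product
  topology, induced by the Euclidean norm) is the standard one.
\<close>

definition P :: "real \<Rightarrow> (real \<times> real) set" where
  "P \<delta> = {0..<2 * pi} \<times> {- \<delta>..\<delta>}"

definition w :: "real \<times> real \<Rightarrow> real \<times> real \<times> real" where
  "w = (\<lambda>(t, r). (cos t + r * cos (t / 2), sin t + r * sin (t / 2), r * sin (t / 2)))"

definition g :: "real \<times> real \<Rightarrow> real" where
  "g = (\<lambda>(x, y). (x\<^sup>2 + y\<^sup>2 - 1)\<^sup>2 / ((x + 1)\<^sup>2 + y\<^sup>2))"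

definition S :: "real \<Rightarrow> (real \<times> real) set" where
  "S \<delta> = {p \<in> UNIV - {(-1, 0)}. g p \<le> \<delta>\<^sup>2}"

text \<open>
  The functions \<open>g\<close> and \<open>f\<close> are meaningful only away from \<open>(-1, 0)\<close>; their junk values there
  are never used, since \<open>(-1, 0) \<notin> S \<delta>\<close>.
\<close>

definition f :: "real \<times> real \<Rightarrow> real" where
  "f = (\<lambda>(x, y). y - 2 * (x + 1) * y / ((x + 1)\<^sup>2 + y\<^sup>2))"

lemma f_alt:
  assumes "(x, y) \<noteq> (-1, 0)"
  shows "f (x, y) = y * ((x\<^sup>2 + y\<^sup>2 - 1) / ((x + 1)\<^sup>2 + y\<^sup>2))"
proof -
  have "(x + 1)\<^sup>2 + y\<^sup>2 \<noteq> 0"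
    using assms by (auto simp: sum_power2_eq_zero_iff)
  then show ?thesis
    by (simp add: f_def divide_simps) (simp add: power2_eq_square algebra_simps)
qed

end

theory Submission
  imports Defs
begin

text \<open>
  Write \<open>c\<close> and \<open>s\<close> for the cosine and sine of \<open>t / 2\<close>, and \<open>\<rho> = 2c + r\<close>. Then the first two
  coordinates of \<open>w (t, r)\<close> are \<open>(-1, 0) + \<rho> (c, s)\<close>, so \<open>(\<rho>, t / 2)\<close> are polar coordinates centred
  at \<open>(-1, 0)\<close>, in which \<open>g = r\<^sup>2\<close> and \<open>f = r s\<close>. Hence the graph of \<open>f\<close> is the part of the
  strip with \<open>\<rho> \<noteq> 0\<close>. On every segment of constant \<open>t\<close>, only one point has \<open>\<rho> = 0\<close>, so this
  part is dense; and the strip is compact because \<open>w (2 * pi, r) = w (0, -r)\<close>.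
\<close>

lemma w_half_angle:
  "w (t, r) = (cos (t / 2) * (2 * cos (t / 2) + r) - 1,
               sin (t / 2) * (2 * cos (t / 2) + r), r * sin (t / 2))"
  using cos_double_cos[of "t / 2"] sin_double[of "t / 2"]
  by (simp add: w_def power2_eq_square algebra_simps)

lemma w_add_2pi: "w (t + 2 * pi, r) = w (t, - r)"
  by (simp add: w_def add_divide_distrib)

lemma continuous_on_w: "continuous_on A w"
  unfolding w_def case_prod_unfold by (intro continuous_intros) auto

context
  fixes c s \<rho> :: real
  assumes unit: "c\<^sup>2 + s\<^sup>2 = 1" and nz: "\<rho> \<noteq> 0"
begin

text \<open>The uncancelled \<open>- 1 + 1\<close> matches the denominator of \<open>g\<close> and
  \<open>f\<close> at \<open>x = c * \<rho> - 1\<close>, so that it can be rewritten in place. The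
  sign of \<open>\<rho>\<close> is left free, because \<open>2 * cos (t / 2) + r\<close> may be
  negative.\<close>

lemma polar_radius: "(c * \<rho> - 1 + 1)\<^sup>2 + (s * \<rho>)\<^sup>2 = \<rho>\<^sup>2"
proof -
  have "(c * \<rho> - 1 + 1)\<^sup>2 + (s * \<rho>)\<^sup>2 = (c\<^sup>2 + s\<^sup>2) * \<rho>\<^sup>2"
    by (simp add: power_mult_distrib algebra_simps)
  then show ?thesis
    by (simp add: unit)
qed

text \<open>Follows from \<open>x\<^sup>2 + y\<^sup>2 - 1 = ((x + 1)\<^sup>2 + y\<^sup>2) - 2 * (x +
  1)\<close> with \<open>x + 1 = c * \<rho>\<close>.\<close>

lemma polar_circle: "(c * \<rho> - 1)\<^sup>2 + (s * \<rho>)\<^sup>2 - 1 = \<rho> * (\<rho> - 2 * c)"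
  using polar_radius by (simp add: power2_eq_square algebra_simps)

lemma g_polar: "g (c * \<rho> - 1, s * \<rho>) = (\<rho> - 2 * c)\<^sup>2"
  unfolding g_def case_prod_conv polar_radius polar_circle
  using nz by (simp add: power_mult_distrib)

lemma polar_noncentral: "(c * \<rho> - 1, s * \<rho>) \<noteq> (- 1, 0)"
  using nz unit by auto

lemma f_polar: "f (c * \<rho> - 1, s * \<rho>) = (\<rho> - 2 * c) * s"
  unfolding f_alt[OF polar_noncentral] polar_radius polar_circle
  using nz by (simp add: power2_eq_square)

lemma polar_in_S_iff: "(c * \<rho> - 1, s * \<rho>) \<in> S \<delta> \<longleftrightarrow> \<bar>\<rho> - 2 * c\<bar> \<le> \<bar>\<delta>\<bar>"
  using polar_noncentral by (simp add: S_def g_polar abs_le_square_iff)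

end

lemma w_in_graph:
  assumes "2 * cos (t / 2) + r \<noteq> 0" "\<bar>r\<bar> \<le> \<delta>"
  shows "w (t, r) \<in> {(x, y, f (x, y)) | x y. (x, y) \<in> S \<delta>}"
proof -
  let ?\<rho> = "2 * cos (t / 2) + r"
  have unit: "(cos (t / 2))\<^sup>2 + (sin (t / 2))\<^sup>2 = 1"
    by simp
  show ?thesis
    using f_polar[OF unit assms(1)] polar_in_S_iff[OF unit assms(1), of \<delta>] assms(2)
    unfolding w_half_angle by simp
qed

lemma w_in_closure_graph:
  assumes "\<delta> > 0" "\<bar>r\<bar> \<le> \<delta>"
  shows "w (t, r) \<in> closure {(x, y, f (x, y)) | x y. (x, y) \<in> S \<delta>}" (is "_ \<in> closure ?G")
proof -
  let ?A = "{- \<delta>..\<delta>} - {- 2 * cos (t / 2)}"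
  \<comment> \<open>Since \<open>\<delta> > 0\<close>, the interval has no isolated point. Inserting
    \<open>- 2 * cos (t / 2)\<close> turns it and \<open>?A\<close> into the same set and preserves
    limit points, so \<open>r\<close> is a limit point of \<open>?A\<close> even if it is the
    deleted point itself.\<close>
  have "r islimpt {- \<delta>..\<delta>}"
    using assms by (simp add: islimpt_Icc abs_le_iff)
  then have "r \<in> closure ?A"
    using islimpt_insert[of r "- 2 * cos (t / 2)" ?A]
      islimpt_insert[of r "- 2 * cos (t / 2)" "{- \<delta>..\<delta>}"]
    by (simp add: closure_def)
  moreover have "(\<lambda>r. w (t, r)) ` closure ?A \<subseteq> closure ?G"
  proof (rule image_closure_subset)
    show "continuous_on (closure ?A) (\<lambda>r. w (t, r))"
      by (rule continuous_on_compose2[OF continuous_on_w[of UNIV]]) (auto intro: continuous_intros)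
    show "(\<lambda>r. w (t, r)) ` ?A \<subseteq> closure ?G"
    proof (intro image_subsetI)
      fix q assume "q \<in> ?A"
      then have "w (t, q) \<in> ?G"
        by (intro w_in_graph) auto
      then show "w (t, q) \<in> closure ?G"
        by (rule subsetD[OF closure_subset])
    qed
  qed simp
  ultimately show ?thesis
    by blast
qed

lemma graph_subset_image:
  assumes "\<delta> > 0"
  shows "{(x, y, f (x, y)) | x y. (x, y) \<in> S \<delta>} \<subseteq> w ` P \<delta>"
proof clarify
  fix x y assume S: "(x, y) \<in> S \<delta>"
  define \<rho> where "\<rho> = sqrt ((x + 1)\<^sup>2 + y\<^sup>2)"
  have sq: "\<rho>\<^sup>2 = (x + 1)\<^sup>2 + y\<^sup>2"
    by (simp add: \<rho>_def)
  have "(x + 1)\<^sup>2 + y\<^sup>2 \<noteq> 0"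
    using S by (auto simp: S_def sum_power2_eq_zero_iff)
  then have nz: "\<rho> \<noteq> 0"
    by (simp add: \<rho>_def)
  have "((x + 1) / \<rho>)\<^sup>2 + (y / \<rho>)\<^sup>2 = 1"
    using nz sq[symmetric] by (simp only: power_divide add_divide_distrib[symmetric]) simp
  then obtain \<theta> where \<theta>: "0 \<le> \<theta>" "\<theta> < 2 * pi" "(x + 1) / \<rho> = cos \<theta>" "y / \<rho> = sin \<theta>"
    by (metis sincos_total_2pi)
  have xy: "x = cos \<theta> * \<rho> - 1" "y = sin \<theta> * \<rho>"
    using \<theta>(3,4) nz by (auto simp: field_simps)
  \<comment> \<open>The polar angle \<open>\<theta>\<close> plays the role of \<open>t / 2\<close>,
    so this solves \<open>\<rho> = 2 * cos (t / 2) + r\<close> for \<open>r\<close>.\<close>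
  define r where "r = \<rho> - 2 * cos \<theta>"
  have unit: "(cos \<theta>)\<^sup>2 + (sin \<theta>)\<^sup>2 = 1"
    by simp
  have r: "\<bar>r\<bar> \<le> \<delta>"
    using S assms polar_in_S_iff[OF unit nz] unfolding xy r_def by simp
  have eq: "(x, y, f (x, y)) = w (2 * \<theta>, r)"
    unfolding xy f_polar[OF unit nz] w_half_angle by (simp add: r_def)
  show "(x, y, f (x, y)) \<in> w ` P \<delta>"
  \<comment> \<open>As \<open>\<theta>\<close> makes a full turn, \<open>t = 2 * \<theta>\<close>
    goes around the strip twice. The second round is brought back into \<open>P \<delta>\<close> by
    subtracting \<open>2 * pi\<close> and reversing the sign of \<open>r\<close>.\<close>
  proof (cases "\<theta> < pi")
    case True
    then show ?thesis
      unfolding eq using r \<theta>(1) by (intro imageI) (simp add: P_def abs_le_iff)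
  next
    case False
    have shift: "w (2 * \<theta>, r) = w (2 * \<theta> - 2 * pi, - r)"
      using w_add_2pi[of "2 * \<theta> - 2 * pi" r] by simp
    show ?thesis
      unfolding eq shift using False r \<theta>(2) by (intro imageI) (simp add: P_def abs_le_iff)
  qed
qed

text \<open>Adding the missing edge \<open>t = 2 * pi\<close> makes the parameter domain compact. It
  adds no point to the image, since it is glued to the edge \<open>t = 0\<close> by
  \<open>r \<mapsto> - r\<close>, which preserves the interval of radii.\<close>

lemma closed_image_P: "closed (w ` P \<delta>)"
proof -
  have "w (t, r) \<in> w ` P \<delta>" if "t \<in> {0..2 * pi}" "r \<in> {- \<delta>..\<delta>}" for t r
  proof (cases "t = 2 * pi")
    case True
    then have "w (t, r) = w (0, - r)"
      using w_add_2pi[of 0 r] by simp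
    moreover have "(0, - r) \<in> P \<delta>"
      using that by (simp add: P_def)
    ultimately show ?thesis
      by simp
  next
    case False
    then have "(t, r) \<in> P \<delta>"
      using that by (simp add: P_def)
    then show ?thesis
      by simp
  qed
  then have "w ` ({0..2 * pi} \<times> {- \<delta>..\<delta>}) \<subseteq> w ` P \<delta>"
    by (simp add: image_subset_iff Ball_def split_paired_All)
  moreover have "w ` P \<delta> \<subseteq> w ` ({0..2 * pi} \<times> {- \<delta>..\<delta>})"
    by (auto simp: P_def)
  ultimately have "w ` P \<delta> = w ` ({0..2 * pi} \<times> {- \<delta>..\<delta>})"
    by blast
  then show ?thesis
    by (simp add: compact_imp_closed compact_continuous_image continuous_on_w compact_Times)
qed

theorem theorem1p3:
  fixes \<delta> :: real
  assumes "\<delta> > 0"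
  shows "w ` P \<delta> = closure {(x, y, f (x, y)) | x y. (x, y) \<in> S \<delta>}"
proof
  show "w ` P \<delta> \<subseteq> closure {(x, y, f (x, y)) | x y. (x, y) \<in> S \<delta>}"
    using w_in_closure_graph[OF assms] by (force simp: P_def abs_le_iff)
  show "closure {(x, y, f (x, y)) | x y. (x, y) \<in> S \<delta>} \<subseteq> w ` P \<delta>"
    using graph_subset_image[OF assms] closed_image_P by (rule closure_minimal)
qed

end
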